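(* Let $Q$ be a finite quandle and let $\rho : Q \to GL(V)$ be an irreducible finite dimensional quandle representation over $\mathbb{C}$, with $V\neq 0$. Define $\chi_\rho : Q\to\mathbb{C}^\times$ by $$\chi_\rho(x)=\frac{1}{\det(\rho(x))^{\frac{1}{\dim(V)}}},\qquad x\in Q.$$ Then the map $\chi_\rho\cdot\rho : Q\to GL(V)$ defined by $(\chi_\rho\cdot\rho)(x)=\chi_\rho(x)\rho(x)$ for $x\in Q$ is an irreducible quandle representation which is unitary with respect to some inner product on $V$.
   Context: A quandle is a set $Q$ with a binary operation $\triangleright$ such that: $x\triangleright x=x$ for all $x\in Q$; for all $x,y\in Q$ there is a unique $z\in Q$ with $x\triangleright z=y$; and $x\triangleright(y\triangleright z)=(x\triangleright y)\triangleright(x\triangleright z)$ for all $x,y,z\in Q$. A quandle representation of $Q$ on a vector space $V$ is a map $\rho:Q\to GL(V)$ with $\rho(x\triangleright y)=\rho(x)\rho(y)\rho(x)^{-1}$ for all $x,y\in Q$. It is irreducible if the only vector subspaces of $V$ stable under all elements of $\rho(Q)$ are $0$ and $V$. It is unitary with respect to an inner product on $V$ if all elements of $\rho(Q)$ are isometries for that inner product. For a nonzero complex number $z=re^{i\theta}$ with $r>0$, $0\le\theta<2\pi$, and a positive integer $n$, one sets $z^{\frac1n}=r^{\frac1n}e^{i\frac{\theta}{n}}$. *)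

theory Defs
  imports
    "HOL-Analysis.Complex_Transcendental"
    "Jordan_Normal_Form.Determinant"
begin

locale quandle =
  fixes Q :: "'q set" and op :: "'q \<Rightarrow> 'q \<Rightarrow> 'q" (infixl "\<triangleright>" 70)
  assumes closed: "x \<in> Q \<Longrightarrow> y \<in> Q \<Longrightarrow> x \<triangleright> y \<in> Q"
    and idem: "x \<in> Q \<Longrightarrow> x \<triangleright> x = x"
    and ex1_left_quotient: "x \<in> Q \<Longrightarrow> y \<in> Q \<Longrightarrow> \<exists>!z. z \<in> Q \<and> x \<triangleright> z = y"
    and self_distrib: "x \<in> Q \<Longrightarrow> y \<in> Q \<Longrightarrow> z \<in> Q \<Longrightarrow> x \<triangleright> (y \<triangleright> z) = (x \<triangleright> y) \<triangleright> (x \<triangleright> z)"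

definition GL :: "('a::field \<Rightarrow> 'v::ab_group_add \<Rightarrow> 'v) \<Rightarrow> ('v \<Rightarrow> 'v) set" where
  "GL sc = {f. Vector_Spaces.linear sc sc f \<and> bij f}"

definition quandle_rep ::
    "('a::field \<Rightarrow> 'v::ab_group_add \<Rightarrow> 'v) \<Rightarrow> 'q set \<Rightarrow> ('q \<Rightarrow> 'q \<Rightarrow> 'q) \<Rightarrow> ('q \<Rightarrow> 'v \<Rightarrow> 'v) \<Rightarrow> bool" where
  "quandle_rep sc Q op \<rho> \<longleftrightarrow>
     (\<forall>x\<in>Q. \<rho> x \<in> GL sc) \<and>
     (\<forall>x\<in>Q. \<forall>y\<in>Q. \<rho> (op x y) = \<rho> x \<circ> \<rho> y \<circ> Hilbert_Choice.inv (\<rho> x))"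

definition irreducible_rep ::
    "('a::field \<Rightarrow> 'v::ab_group_add \<Rightarrow> 'v) \<Rightarrow> 'q set \<Rightarrow> ('q \<Rightarrow> 'v \<Rightarrow> 'v) \<Rightarrow> bool" where
  "irreducible_rep sc Q \<rho> \<longleftrightarrow>
     (\<forall>W. Modules.module.subspace sc W \<and> (\<forall>x\<in>Q. \<rho> x ` W \<subseteq> W) \<longrightarrow> W = {0} \<or> W = UNIV)"

definition ordered_basis ::
    "('a::field \<Rightarrow> 'v::ab_group_add \<Rightarrow> 'v) \<Rightarrow> 'v list \<Rightarrow> bool" where
  "ordered_basis sc bs \<longleftrightarrow>
     distinct bs \<and> \<not> Modules.module.dependent sc (set bs) \<and>
     Modules.module.span sc (set bs) = UNIV"

text \<open>Column \<open>j\<close> consists of the coordinates of \<open>f (bs ! j)\<close>.\<close>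

definition matrix_of ::
    "('a::field \<Rightarrow> 'v::ab_group_add \<Rightarrow> 'v) \<Rightarrow> 'v list \<Rightarrow> ('v \<Rightarrow> 'v) \<Rightarrow> 'a mat" where
  "matrix_of sc bs f = mat (length bs) (length bs)
     (\<lambda>(i, j). Modules.module.representation sc (set bs) (f (bs ! j)) (bs ! i))"

text \<open>The determinant of an endomorphism of a finite dimensional space. It does not depend on
  the chosen basis: see \<open>endo_det_eq\<close> below.\<close>

definition endo_det ::
    "('a::field \<Rightarrow> 'v::ab_group_add \<Rightarrow> 'v) \<Rightarrow> ('v \<Rightarrow> 'v) \<Rightarrow> 'a" where
  "endo_det sc f =
     Determinant.det (matrix_of sc (SOME bs. ordered_basis sc bs) f)"

context vector_space
begin

lemma sum_ordered_basis:
  assumes "ordered_basis scale bs"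
  shows "(\<Sum>k<length bs. representation (set bs) v (bs ! k) *s (bs ! k)) = v"
proof -
  have "(\<Sum>k<length bs. representation (set bs) v (bs ! k) *s (bs ! k))
      = (\<Sum>b\<in>set bs. representation (set bs) v b *s b)"
    using assms unfolding ordered_basis_def
    by (intro sum.reindex_bij_betw bij_betw_nth) auto
  also have "\<dots> = v"
    using assms unfolding ordered_basis_def by (intro sum_representation_eq) auto
  finally show ?thesis .
qed

lemma representation_linear_expand:
  assumes bs: "ordered_basis scale bs" and cs: "ordered_basis scale cs"
    and f: "Vector_Spaces.linear scale scale f"
  shows "representation (set cs) (f v) c
    = (\<Sum>k<length bs. representation (set bs) v (bs ! k) * representation (set cs) (f (bs ! k)) c)"
proof -
  interpret f: Vector_Spaces.linear scale scale f by (rule f)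
  have cs': "independent (set cs)" "span (set cs) = UNIV"
    using cs by (auto simp: ordered_basis_def)
  have "f v = f (\<Sum>k<length bs. representation (set bs) v (bs ! k) *s (bs ! k))"
    by (simp add: sum_ordered_basis[OF bs])
  also have "\<dots> = (\<Sum>k<length bs. representation (set bs) v (bs ! k) *s f (bs ! k))"
    by (simp add: f.sum f.scale)
  finally show ?thesis
    using cs' by (simp add: representation_sum representation_scale)
qed

lemma matrix_of_comp:
  assumes "ordered_basis scale bs" and "Vector_Spaces.linear scale scale f"
  shows "matrix_of scale bs (f \<circ> g) = matrix_of scale bs f * matrix_of scale bs g"
proof (rule eq_matI)
  fix i j assume "i < dim_row (matrix_of scale bs f * matrix_of scale bs g)"
    "j < dim_col (matrix_of scale bs f * matrix_of scale bs g)"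
  then show "matrix_of scale bs (f \<circ> g) $$ (i, j) = (matrix_of scale bs f * matrix_of scale bs g) $$ (i, j)"
    using representation_linear_expand[OF assms(1,1,2), of "g (bs ! j)" "bs ! i"]
    by (simp add: matrix_of_def scalar_prod_def mult.commute lessThan_atLeast0)
qed (simp_all add: matrix_of_def)

lemma det_matrix_of_unique:
  assumes bs: "ordered_basis scale bs" and cs: "ordered_basis scale cs"
    and f: "Vector_Spaces.linear scale scale f"
  shows "Determinant.det (matrix_of scale bs f) = Determinant.det (matrix_of scale cs f)"
proof -
  let ?n = "length bs"
  define P where "P = (\<lambda>xs ys. mat (length xs) (length ys)
    (\<lambda>(i, j). representation (set xs) (ys ! j) (xs ! i)))"
  have len: "length cs = ?n"
    using bs cs unfolding ordered_basis_def
    by (metis bij_betw_same_card bij_if_span_eq_span_bases distinct_card)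
  have id: "Vector_Spaces.linear scale scale (\<lambda>x. x)"
    by (rule linear_id[unfolded id_def])
  have P_inv: "P xs ys * P ys xs = 1\<^sub>m (length xs)"
    if "ordered_basis scale xs" "ordered_basis scale ys" for xs ys
  proof (rule eq_matI)
    fix i j assume "i < dim_row (1\<^sub>m (length xs) :: 'a mat)" "j < dim_col (1\<^sub>m (length xs) :: 'a mat)"
    then have ij: "i < length xs" "j < length xs" by simp_all
    have "representation (set xs) (xs ! j) (xs ! i) = (if i = j then 1 else 0)"
      using that ij by (simp add: representation_basis ordered_basis_def nth_eq_iff_index_eq)
    moreover have "representation (set xs) (xs ! j) (xs ! i) =
      (\<Sum>k<length ys. representation (set ys) (xs ! j) (ys ! k) * representation (set xs) (ys ! k) (xs ! i))"
      by (rule representation_linear_expand[OF that(2,1) id])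
    ultimately show "(P xs ys * P ys xs) $$ (i, j) = 1\<^sub>m (length xs) $$ (i, j)"
      using ij by (simp add: P_def scalar_prod_def lessThan_atLeast0 mult.commute)
  qed (simp_all add: P_def)
  have eq: "matrix_of scale bs f = P bs cs * matrix_of scale cs f * P cs bs"
  proof -
    have "matrix_of scale cs f * P cs bs = P cs bs * matrix_of scale bs f"
    proof (rule eq_matI)
      fix i j assume "i < dim_row (P cs bs * matrix_of scale bs f)" "j < dim_col (P cs bs * matrix_of scale bs f)"
      then have ij: "i < length cs" "j < ?n"
        by (simp_all add: P_def matrix_of_def)
      show "(matrix_of scale cs f * P cs bs) $$ (i, j) = (P cs bs * matrix_of scale bs f) $$ (i, j)"
        using ij representation_linear_expand[OF cs cs f, of "bs ! j" "cs ! i"]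
          representation_linear_expand[OF bs cs id, of "f (bs ! j)" "cs ! i"]
        by (simp add: P_def matrix_of_def scalar_prod_def lessThan_atLeast0 mult.commute)
    qed (simp_all add: P_def matrix_of_def)
    moreover have "P bs cs * matrix_of scale cs f * P cs bs = P bs cs * (matrix_of scale cs f * P cs bs)"
      by (rule assoc_mult_mat) (auto simp: P_def matrix_of_def)
    moreover have "P bs cs * (P cs bs * matrix_of scale bs f) = P bs cs * P cs bs * matrix_of scale bs f"
      by (rule assoc_mult_mat[symmetric]) (auto simp: P_def matrix_of_def)
    moreover have "1\<^sub>m ?n * matrix_of scale bs f = matrix_of scale bs f"
      by (rule left_mult_one_mat[of _ _ ?n]) (simp add: matrix_of_def)
    ultimately show ?thesis
      by (simp add: P_inv[OF bs cs])
  qed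
  have "similar_mat (matrix_of scale bs f) (matrix_of scale cs f)"
  proof (rule similar_matI[OF _ _ _ eq])
    show "{matrix_of scale bs f, matrix_of scale cs f, P bs cs, P cs bs} \<subseteq> carrier_mat ?n ?n"
      by (simp add: matrix_of_def P_def len)
  qed (use P_inv[OF bs cs] P_inv[OF cs bs] len in simp_all)
  then show ?thesis by (rule det_similar)
qed

end

context finite_dimensional_vector_space
begin

lemma ex_ordered_basis: "\<exists>bs. ordered_basis scale bs"
proof -
  obtain bs where "set bs = Basis" "distinct bs"
    using finite_distinct_list[OF finite_Basis] by blast
  then show ?thesis
    using independent_Basis span_Basis by (auto simp: ordered_basis_def)
qed

lemma endo_det_eq:
  assumes "ordered_basis scale bs" and "Vector_Spaces.linear scale scale f"
  shows "endo_det scale f = Determinant.det (matrix_of scale bs f)"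
proof -
  have "ordered_basis scale (SOME bs. ordered_basis scale bs)"
    using ex_ordered_basis by (rule someI_ex)
  then show ?thesis
    unfolding endo_det_def using assms by (rule det_matrix_of_unique)
qed

end

text \<open>The branch \<open>r^(1/n) e^(i\<theta>/n)\<close> of \<open>z^(1/n)\<close>, where \<open>z = r e^(i\<theta>)\<close> with \<open>0 \<le> \<theta> < 2\<pi>\<close>.
  This is not the branch of \<open>powr\<close>, which uses arguments in \<open>(-\<pi>, \<pi>]\<close>.\<close>

definition nth_root :: "nat \<Rightarrow> complex \<Rightarrow> complex" where
  "nth_root n z = of_real (root n (cmod z)) * exp (\<i> * of_real (Arg2pi z / real n))"

definition det_character ::
    "(complex \<Rightarrow> 'v::ab_group_add \<Rightarrow> 'v) \<Rightarrow> ('q \<Rightarrow> 'v \<Rightarrow> 'v) \<Rightarrow> 'q \<Rightarrow> complex" where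
  "det_character sc \<rho> x =
     1 / nth_root (vector_space.dim sc UNIV) (endo_det sc (\<rho> x))"

definition twist ::
    "(complex \<Rightarrow> 'v \<Rightarrow> 'v) \<Rightarrow> ('q \<Rightarrow> complex) \<Rightarrow> ('q \<Rightarrow> 'v \<Rightarrow> 'v) \<Rightarrow> 'q \<Rightarrow> 'v \<Rightarrow> 'v" where
  "twist sc c \<rho> x v = sc (c x) (\<rho> x v)"

text \<open>\<open>ip\<close> is linear in its first argument; by Hermitian symmetry
  \<open>ip v v\<close> is real, so positivity can be stated with \<open>Re\<close>.\<close>

definition inner_product ::
    "(complex \<Rightarrow> 'v \<Rightarrow> 'v::ab_group_add) \<Rightarrow> ('v \<Rightarrow> 'v \<Rightarrow> complex) \<Rightarrow> bool" where
  "inner_product sc ip \<longleftrightarrow>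
     (\<forall>u v w. ip (u + v) w = ip u w + ip v w) \<and>
     (\<forall>c v w. ip (sc c v) w = c * ip v w) \<and>
     (\<forall>v w. ip w v = cnj (ip v w)) \<and>
     (\<forall>v. v \<noteq> 0 \<longrightarrow> 0 < Re (ip v v))"

definition unitary_rep :: "'q set \<Rightarrow> ('q \<Rightarrow> 'v \<Rightarrow> 'v) \<Rightarrow> ('v \<Rightarrow> 'v \<Rightarrow> complex) \<Rightarrow> bool" where
  "unitary_rep Q \<rho> ip \<longleftrightarrow> (\<forall>x\<in>Q. \<forall>v w. ip (\<rho> x v) (\<rho> x w) = ip v w)"

end

theory Submission
  imports Defs "Jordan_Normal_Form.Char_Poly"
begin

text \<open>Put \<open>A x = \<chi>\<^sub>\<rho>(x) \<rho>(x)\<close>, which has determinant \<open>1\<close>. Let \<open>G\<close> be the set of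
  automorphisms of determinant \<open>1\<close> that permute \<open>\<rho>(Q)\<close> by conjugation; it is closed under
  composition and contains every \<open>A x\<close>. Two elements of \<open>G\<close> inducing the same map on
  \<open>\<rho>(Q)\<close> differ by an automorphism commuting with \<open>\<rho>(Q)\<close>, that is, by Schur's lemma, by a
  scalar, which is a root of unity of order dividing \<open>dim V\<close>. As \<open>Q\<close> is finite, so is \<open>G\<close>,
  and averaging any inner product over \<open>G\<close> makes all \<open>A x\<close> unitary.\<close>

section \<open>Complex roots and the quandle relation without inverses\<close>

lemma nth_root_power:
  assumes "n > 0"
  shows "nth_root n z ^ n = z"
proof -
  have "nth_root n z ^ n
      = of_real (root n (cmod z) ^ n) * exp (of_nat n * (\<i> * of_real (Arg2pi z / real n)))"
    unfolding nth_root_def by (simp only: power_mult_distrib exp_of_nat_mult of_real_power)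
  also have "of_nat n * (\<i> * of_real (Arg2pi z / real n)) = \<i> * of_real (Arg2pi z)"
    using assms by simp
  also have "root n (cmod z) ^ n = cmod z"
    using assms by simp
  also have "of_real (cmod z) * exp (\<i> * of_real (Arg2pi z)) = z"
    using Arg2pi_eq[of z] by simp
  finally show ?thesis .
qed

lemma twist_eq: "twist sc c \<rho> x = (\<lambda>v. sc (c x) (\<rho> x v))"
  by (simp add: twist_def fun_eq_iff)

text \<open>Clearing the inverse turns conjugation into an intertwining relation, to which
  determinants and scalar factors apply directly. \<open>quandle_repI\<close> goes back, cancelling
  by surjectivity.\<close>

lemma quandle_rep_comp:
  assumes "quandle_rep sc Q op \<rho>" and "x \<in> Q" and "y \<in> Q"
  shows "\<rho> (op x y) \<circ> \<rho> x = \<rho> x \<circ> \<rho> y"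
proof -
  have "bij (\<rho> x)" and "\<rho> (op x y) = \<rho> x \<circ> \<rho> y \<circ> Hilbert_Choice.inv (\<rho> x)"
    using assms by (auto simp: quandle_rep_def GL_def)
  then show ?thesis
    by (simp add: comp_assoc bij_is_inj)
qed

lemma quandle_repI:
  assumes "\<And>x. x \<in> Q \<Longrightarrow> \<rho> x \<in> GL sc"
    and "\<And>x y. x \<in> Q \<Longrightarrow> y \<in> Q \<Longrightarrow> \<rho> (op x y) \<circ> \<rho> x = \<rho> x \<circ> \<rho> y"
  shows "quandle_rep sc Q op \<rho>"
  unfolding quandle_rep_def
proof (intro conjI ballI)
  fix x y assume xy: "x \<in> Q" "y \<in> Q"
  then have "surj (\<rho> x)"
    using assms(1) by (auto simp: GL_def bij_is_surj)
  then have "\<rho> (op x y) = \<rho> (op x y) \<circ> \<rho> x \<circ> Hilbert_Choice.inv (\<rho> x)"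
    by (simp add: comp_assoc surj_iff)
  then show "\<rho> (op x y) = \<rho> x \<circ> \<rho> y \<circ> Hilbert_Choice.inv (\<rho> x)"
    by (simp add: assms(2) xy)
qed (use assms(1) in auto)

section \<open>Invertible linear maps and their matrices\<close>

context vector_space
begin

lemma linear_scale_comp:
  "Vector_Spaces.linear scale scale f \<Longrightarrow> Vector_Spaces.linear scale scale (\<lambda>v. scale c (f v))"
  by (simp add: Vector_Spaces.linear_iff scale_right_distrib mult.commute)

lemma GL_comp: "f \<in> GL scale \<Longrightarrow> g \<in> GL scale \<Longrightarrow> f \<circ> g \<in> GL scale"
  by (auto simp: GL_def intro: Vector_Spaces.linear_compose bij_comp)

lemma GL_scale:
  assumes "f \<in> GL scale" and "c \<noteq> 0"
  shows "(\<lambda>v. scale c (f v)) \<in> GL scale"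
proof -
  have lin: "Vector_Spaces.linear scale scale f" and bij: "bij f"
    using assms(1) by (auto simp: GL_def)
  have "bij (\<lambda>v. scale c v)"
    by (rule o_bij[of "\<lambda>v. scale (inverse c) v"]) (use assms(2) in \<open>auto simp: fun_eq_iff\<close>)
  from bij_comp[OF bij this] have "bij (\<lambda>v. scale c (f v))"
    by (simp add: o_def)
  with lin show ?thesis
    by (simp add: GL_def linear_scale_comp)
qed

lemma inv_in_GL:
  assumes "f \<in> GL scale"
  shows "Hilbert_Choice.inv f \<in> GL scale"
proof -
  have lin: "Vector_Spaces.linear scale scale f" and bij: "bij f"
    using assms by (auto simp: GL_def)
  interpret f: Vector_Spaces.linear scale scale f by (rule lin)
  have "Vector_Spaces.linear scale scale (Hilbert_Choice.inv f)"
  proof unfold_locales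
    fix u v c
    show "Hilbert_Choice.inv f (u + v) = Hilbert_Choice.inv f u + Hilbert_Choice.inv f v"
      using bij by (intro inv_f_eq) (simp_all add: bij_is_inj f.add bij_is_surj surj_f_inv_f)
    show "Hilbert_Choice.inv f (scale c u) = scale c (Hilbert_Choice.inv f u)"
      using bij by (intro inv_f_eq) (simp_all add: bij_is_inj f.scale bij_is_surj surj_f_inv_f)
  qed
  with bij show ?thesis by (simp add: GL_def bij_imp_bij_inv)
qed

lemma length_ordered_basis: "ordered_basis scale bs \<Longrightarrow> length bs = dim UNIV"
  unfolding ordered_basis_def by (metis dim_eq_card distinct_card span_UNIV)

lemma matrix_of_carrier: "matrix_of scale bs f \<in> carrier_mat (length bs) (length bs)"
  by (simp add: matrix_of_def)

lemma matrix_of_scale: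
  assumes "ordered_basis scale bs"
  shows "matrix_of scale bs (\<lambda>v. scale c (f v)) = c \<cdot>\<^sub>m matrix_of scale bs f"
  using assms by (intro eq_matI) (auto simp: matrix_of_def ordered_basis_def representation_scale)

lemma matrix_of_diff:
  assumes "ordered_basis scale bs"
  shows "matrix_of scale bs (\<lambda>v. f v - g v) = matrix_of scale bs f - matrix_of scale bs g"
  using assms by (intro eq_matI) (auto simp: matrix_of_def ordered_basis_def representation_diff)

lemma matrix_of_id:
  assumes "ordered_basis scale bs"
  shows "matrix_of scale bs (\<lambda>v. v) = 1\<^sub>m (length bs)"
  using assms
  by (intro eq_matI)
    (auto simp: matrix_of_def ordered_basis_def representation_basis nth_eq_iff_index_eq)

end

section \<open>Twisting by a nonzero scalar function\<close>

text \<open>A subspace stable under the twist is stable under \<open>\<rho>\<close>, because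
  multiplying by \<open>inverse (c x)\<close> stays inside it.\<close>

lemma irreducible_rep_twist:
  fixes sc :: "complex \<Rightarrow> 'v::ab_group_add \<Rightarrow> 'v"
  assumes "vector_space sc" and "irreducible_rep sc Q \<rho>" and nz: "\<And>x. x \<in> Q \<Longrightarrow> c x \<noteq> 0"
  shows "irreducible_rep sc Q (twist sc c \<rho>)"
proof -
  interpret vector_space sc by (rule assms(1))
  show ?thesis
    unfolding irreducible_rep_def
  proof (intro allI impI)
    fix W assume W: "subspace W \<and> (\<forall>x\<in>Q. twist sc c \<rho> x ` W \<subseteq> W)"
    have "\<rho> x v \<in> W" if "x \<in> Q" "v \<in> W" for x v
    proof -
      have "sc (c x) (\<rho> x v) \<in> W"
        using W that by (auto simp: twist_def)
      then have "sc (inverse (c x)) (sc (c x) (\<rho> x v)) \<in> W"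
        using W by (blast intro: subspace_scale)
      then show ?thesis using nz[OF that(1)] by simp
    qed
    with W assms(2) show "W = {0} \<or> W = UNIV"
      unfolding irreducible_rep_def by blast
  qed
qed

text \<open>In the intertwining relation the left side acquires the factor
  \<open>c (op x y) * c x\<close> and the right side \<open>c x * c y\<close>; these agree because
  \<open>c\<close> is invariant under the quandle action.\<close>

lemma quandle_rep_twist:
  fixes sc :: "complex \<Rightarrow> 'v::ab_group_add \<Rightarrow> 'v"
  assumes "vector_space sc" and rep: "quandle_rep sc Q op \<rho>"
    and closed: "\<And>x y. x \<in> Q \<Longrightarrow> y \<in> Q \<Longrightarrow> op x y \<in> Q"
    and nz: "\<And>x. x \<in> Q \<Longrightarrow> c x \<noteq> 0"
    and inv: "\<And>x y. x \<in> Q \<Longrightarrow> y \<in> Q \<Longrightarrow> c (op x y) = c y"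
  shows "quandle_rep sc Q op (twist sc c \<rho>)"
proof -
  interpret vector_space sc by (rule assms(1))
  show ?thesis
  proof (rule quandle_repI)
    fix x assume "x \<in> Q"
    with rep nz show "twist sc c \<rho> x \<in> GL sc"
      by (auto simp: twist_eq quandle_rep_def intro: GL_scale)
  next
    fix x y assume xy: "x \<in> Q" "y \<in> Q"
    have scale: "\<rho> z (sc a v) = sc a (\<rho> z v)" if "z \<in> Q" for z a v
      using rep that by (auto simp: quandle_rep_def GL_def Vector_Spaces.linear_iff)
    have "\<rho> (op x y) (\<rho> x v) = \<rho> x (\<rho> y v)" for v
      using quandle_rep_comp[OF rep xy] by (metis comp_apply)
    then show "twist sc c \<rho> (op x y) \<circ> twist sc c \<rho> x = twist sc c \<rho> x \<circ> twist sc c \<rho> y"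
      by (simp add: twist_def fun_eq_iff scale xy closed inv mult.commute)
  qed
qed

section \<open>Determinants of endomorphisms\<close>

context finite_dimensional_vector_space
begin

lemma endo_det_comp:
  assumes "Vector_Spaces.linear scale scale f" and "Vector_Spaces.linear scale scale g"
  shows "endo_det scale (f \<circ> g) = endo_det scale f * endo_det scale g"
proof -
  obtain bs where bs: "ordered_basis scale bs"
    using ex_ordered_basis by blast
  show ?thesis
    using assms Vector_Spaces.linear_compose[OF assms(2,1)]
    by (simp add: endo_det_eq[OF bs] matrix_of_comp[OF bs] det_mult[OF matrix_of_carrier matrix_of_carrier])
qed

lemma endo_det_scale:
  assumes "Vector_Spaces.linear scale scale f"
  shows "endo_det scale (\<lambda>v. scale c (f v)) = c ^ dim UNIV * endo_det scale f"
proof -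
  obtain bs where bs: "ordered_basis scale bs"
    using ex_ordered_basis by blast
  have "dim_col (matrix_of scale bs f) = dim UNIV"
    using length_ordered_basis[OF bs] by (simp add: matrix_of_def)
  then show ?thesis
    using assms linear_scale_comp[OF assms]
    by (simp add: endo_det_eq[OF bs] matrix_of_scale[OF bs])
qed

lemma endo_det_id: "endo_det scale (\<lambda>v. v) = 1"
proof -
  obtain bs where bs: "ordered_basis scale bs"
    using ex_ordered_basis by blast
  show ?thesis
    using linear_ident by (simp add: endo_det_eq[OF bs] matrix_of_id[OF bs])
qed

lemma endo_det_nonzero:
  assumes "f \<in> GL scale"
  shows "endo_det scale f \<noteq> 0"
proof -
  have "f \<circ> Hilbert_Choice.inv f = (\<lambda>v. v)"
    using assms by (auto simp: GL_def bij_is_surj surj_f_inv_f)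
  moreover have "endo_det scale (f \<circ> Hilbert_Choice.inv f)
      = endo_det scale f * endo_det scale (Hilbert_Choice.inv f)"
    using assms inv_in_GL[OF assms] by (intro endo_det_comp) (auto simp: GL_def)
  ultimately show ?thesis
    by (auto simp: endo_det_id)
qed

text \<open>Conjugate maps have equal determinants: take determinants in
  \<open>quandle_rep_comp\<close> and cancel the nonzero factor of \<open>\<rho> x\<close>. This
  supplies the invariance of scalars demanded by \<open>quandle_rep_twist\<close>.\<close>

lemma endo_det_quandle_rep:
  assumes rep: "quandle_rep scale Q op \<rho>" and "x \<in> Q" and "y \<in> Q" and "op x y \<in> Q"
  shows "endo_det scale (\<rho> (op x y)) = endo_det scale (\<rho> y)"
proof -
  have GL: "\<rho> z \<in> GL scale" if "z \<in> Q" for z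
    using rep that by (simp add: quandle_rep_def)
  then have "endo_det scale (\<rho> (op x y)) * endo_det scale (\<rho> x)
      = endo_det scale (\<rho> x) * endo_det scale (\<rho> y)"
    using arg_cong[OF quandle_rep_comp[OF rep assms(2,3)], of "endo_det scale"] assms(2-)
    by (simp add: endo_det_comp GL_def)
  then show ?thesis
    using endo_det_nonzero[OF GL[OF assms(2)]] by (simp add: mult.commute)
qed

lemma dim_UNIV_pos:
  assumes "\<exists>v::'b. v \<noteq> 0"
  shows "dim UNIV > 0"
proof (rule ccontr)
  assume "\<not> dim UNIV > 0"
  then have "UNIV \<subseteq> {0::'b}" by (simp add: dim_eq_0 del: dim_UNIV)
  with assms show False by auto
qed

end

section \<open>Eigenvectors and Schur's lemma\<close>

text \<open>A root \<open>c\<close> of the characteristic polynomial of a matrix of \<open>f\<close>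
  makes \<open>f - c\<close> have determinant zero. So \<open>f - c\<close> is not invertible, and
  any nonzero vector of its kernel is an eigenvector.\<close>

lemma ex_eigenvector:
  fixes sc :: "complex \<Rightarrow> 'v::ab_group_add \<Rightarrow> 'v"
  assumes "finite_dimensional_vector_space sc B" and "\<exists>v::'v. v \<noteq> 0"
    and f: "Vector_Spaces.linear sc sc f"
  shows "\<exists>c v. v \<noteq> 0 \<and> f v = sc c v"
proof -
  interpret finite_dimensional_vector_space sc B by fact
  obtain bs where bs: "ordered_basis sc bs"
    using ex_ordered_basis by blast
  let ?n = "length bs" and ?M = "matrix_of sc bs f"
  have M: "?M \<in> carrier_mat ?n ?n"
    by (rule matrix_of_carrier)
  \<comment> \<open>The degree is the dimension, which is positive because the space is nonzero; so
    the fundamental theorem of algebra applies.\<close>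
  have "degree (char_poly ?M) \<noteq> 0"
    using degree_monic_char_poly[OF M] dim_UNIV_pos[OF assms(2)] length_ordered_basis[OF bs] by simp
  then obtain c where "poly (char_poly ?M) c = 0"
    using fundamental_theorem_of_algebra by (metis constant_degree)
  then have det0: "Determinant.det (char_matrix ?M c) = 0"
    using eigenvalue_root_char_poly[OF M] eigenvalue_det[OF M] by blast
  define h where "h = (\<lambda>v. f v - sc c v)"
  have h: "Vector_Spaces.linear sc sc h"
    unfolding h_def using f by (simp add: Vector_Spaces.linear_iff algebra_simps)
  have "matrix_of sc bs h = char_matrix ?M c"
    unfolding h_def matrix_of_diff[OF bs] matrix_of_scale[OF bs] matrix_of_id[OF bs] char_matrix_def
    by (intro eq_matI) (auto simp: matrix_of_def)
  then have "endo_det sc h = 0"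
    using det0 by (simp add: endo_det_eq[OF bs h])
  then have "\<not> bij h"
    using endo_det_nonzero[of h] h by (auto simp: GL_def)
  \<comment> \<open>In finite dimension an injective endomorphism is also surjective, so failure of
    bijectivity already forces a nontrivial kernel.\<close>
  then have "\<not> inj h"
    using linear_inj_imp_surj[OF h] by (auto simp: bij_def)
  interpret h: Vector_Spaces.linear sc sc h by (rule h)
  from \<open>\<not> inj h\<close> obtain v where "v \<noteq> 0" "h v = 0"
    using h.inj_iff_eq_0 by blast
  then show ?thesis
    by (auto simp: h_def)
qed

text \<open>An eigenspace of \<open>f\<close> is stable under every \<open>\<rho> x\<close>, since
  these commute with \<open>f\<close>. It contains a nonzero vector, so irreducibility makes it the
  whole space.\<close>

lemma schur_scalar:
  fixes sc :: "complex \<Rightarrow> 'v::ab_group_add \<Rightarrow> 'v"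
  assumes "finite_dimensional_vector_space sc B" and "\<exists>v::'v. v \<noteq> 0"
    and irr: "irreducible_rep sc Q \<rho>"
    and lin: "\<And>x. x \<in> Q \<Longrightarrow> Vector_Spaces.linear sc sc (\<rho> x)"
    and f: "Vector_Spaces.linear sc sc f"
    and comm: "\<And>x. x \<in> Q \<Longrightarrow> f \<circ> \<rho> x = \<rho> x \<circ> f"
  shows "\<exists>c. f = sc c"
proof -
  interpret finite_dimensional_vector_space sc B by fact
  interpret f: Vector_Spaces.linear sc sc f by (rule f)
  obtain c v where v: "v \<noteq> 0" "f v = sc c v"
    using ex_eigenvector[OF assms(1,2) f] by blast
  let ?W = "{w. f w = sc c w}"
  have "subspace ?W"
    by (rule subspaceI) (auto simp: f.add f.scale scale_right_distrib mult.commute)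
  moreover have "\<rho> x w \<in> ?W" if "x \<in> Q" "f w = sc c w" for x w
  proof -
    interpret r: Vector_Spaces.linear sc sc "\<rho> x" using that lin by blast
    have "f (\<rho> x w) = \<rho> x (f w)" using comm[OF that(1)] by (metis comp_apply)
    then show ?thesis using that by (simp add: r.scale)
  qed
  ultimately have "?W = {0} \<or> ?W = UNIV"
    using irr unfolding irreducible_rep_def by blast
  with v have "?W = UNIV" by blast
  then show ?thesis by (auto simp: fun_eq_iff)
qed

section \<open>Inner products and averaging\<close>

text \<open>The standard Hermitian form in the coordinates of the basis \<open>B\<close> works:
  \<open>ip v v\<close> is the sum of the squared moduli of the coordinates of
  \<open>v\<close>.\<close>

lemma ex_inner_product:
  fixes sc :: "complex \<Rightarrow> 'v::ab_group_add \<Rightarrow> 'v"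
  assumes "finite_dimensional_vector_space sc B"
  shows "\<exists>ip. inner_product sc ip"
proof -
  interpret finite_dimensional_vector_space sc B by fact
  have B: "independent B" "span B = UNIV" "finite B"
    using independent_Basis span_Basis finite_Basis by auto
  let ?r = "representation B"
  define ip where "ip = (\<lambda>v w. \<Sum>b\<in>B. ?r v b * cnj (?r w b))"
  have "0 < Re (ip v v)" if "v \<noteq> 0" for v
  proof -
    have "v = (\<Sum>b\<in>B. sc (?r v b) b)"
      using sum_representation_eq[of B v B] B by simp
    with that obtain b where b: "b \<in> B" "?r v b \<noteq> 0"
      by (metis (no_types, lifting) scale_zero_left sum.neutral)
    have "ip v v = (\<Sum>b\<in>B. of_real ((cmod (?r v b))\<^sup>2))"
      unfolding ip_def by (simp only: complex_norm_square)
    then have "Re (ip v v) = (\<Sum>b\<in>B. (cmod (?r v b))\<^sup>2)"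
      by simp
    also have "\<dots> > 0"
      using B b by (intro sum_pos2[of _ b]) auto
    finally show ?thesis .
  qed
  then have "inner_product sc ip"
    using B unfolding inner_product_def
    by (auto simp: ip_def representation_add representation_scale distrib_right sum.distrib
        sum_distrib_left mult.assoc mult.commute[of "cnj _"])
  then show ?thesis by blast
qed

text \<open>Summing the pullbacks of one inner product over \<open>G\<close> gives an invariant one,
  since right translation by an element of \<open>G\<close> only reorders the summands.\<close>

lemma ex_invariant_inner_product:
  fixes sc :: "complex \<Rightarrow> 'v::ab_group_add \<Rightarrow> 'v"
  assumes "finite_dimensional_vector_space sc B"
    and fin: "finite G" and ne: "G \<noteq> {}" and GL: "G \<subseteq> GL sc"
    and comp: "\<And>f g. f \<in> G \<Longrightarrow> g \<in> G \<Longrightarrow> f \<circ> g \<in> G"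
  shows "\<exists>ip. inner_product sc ip \<and> (\<forall>g\<in>G. \<forall>v w. ip (g v) (g w) = ip v w)"
proof -
  interpret finite_dimensional_vector_space sc B by fact
  obtain ip0 where ip0: "inner_product sc ip0"
    using ex_inner_product assms(1) by blast
  define ip where "ip = (\<lambda>v w. \<Sum>g\<in>G. ip0 (g v) (g w))"
  have lin: "g (u + v) = g u + g v" "g (sc c v) = sc c (g v)" if "g \<in> G" for g u v c
    using GL that by (auto simp: GL_def Vector_Spaces.linear_iff)
  have ip0_lin: "ip0 (u + v) w = ip0 u w + ip0 v w" "ip0 (sc c v) w = c * ip0 v w" for u v w c
    using ip0 unfolding inner_product_def by blast+
  have herm: "ip0 w v = cnj (ip0 v w)" for v w
    using ip0 unfolding inner_product_def by blast
  have pos: "0 < Re (ip v v)" if "v \<noteq> 0" for v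
  proof -
    have "g v \<noteq> 0" if "g \<in> G" for g
    proof
      assume "g v = 0"
      moreover have "g 0 = 0" using lin(2)[OF that, of 0 0] by simp
      moreover have "inj g" using GL that by (auto simp: GL_def bij_is_inj)
      ultimately show False using \<open>v \<noteq> 0\<close> by (metis injD)
    qed
    then have "0 < Re (ip0 (g v) (g v))" if "g \<in> G" for g
      using ip0 that unfolding inner_product_def by blast
    then show ?thesis
      using fin ne unfolding ip_def Re_sum by (intro sum_pos)
  qed
  have "inner_product sc ip"
    unfolding inner_product_def
  proof (intro conjI allI impI)
    fix u v w c
    show "ip (u + v) w = ip u w + ip v w" "ip (sc c v) w = c * ip v w"
      by (simp_all add: ip_def lin ip0_lin sum.distrib sum_distrib_left)
    show "ip w v = cnj (ip v w)"
      unfolding ip_def cnj_sum by (intro sum.cong refl herm)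
  qed (rule pos)
  moreover have "ip (a v) (a w) = ip v w" if a: "a \<in> G" for a v w
  proof -
    have "surj a" using GL a by (auto simp: GL_def bij_is_surj)
    \<comment> \<open>A surjective \<open>a\<close> can be cancelled on the right. An injective
      self-map of the finite set \<open>G\<close> is then onto, so no inverses in \<open>G\<close>
      are required.\<close>
    then have inj: "inj_on (\<lambda>g. g \<circ> a) G"
      by (intro inj_onI) (metis comp_assoc comp_id surj_iff)
    then have "(\<lambda>g. g \<circ> a) ` G = G"
      using comp a by (intro endo_inj_surj fin) auto
    then have "ip v w = (\<Sum>g\<in>(\<lambda>g. g \<circ> a) ` G. ip0 (g v) (g w))"
      by (simp add: ip_def)
    also have "\<dots> = ip (a v) (a w)"
      using inj by (simp add: sum.reindex ip_def)
    finally show ?thesis by simp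
  qed
  ultimately show ?thesis by blast
qed

section \<open>The finite normalizer of determinant one\<close>

text \<open>Conjugation is written as an intertwining relation, which composes directly. It only
  says that conjugates of elements of \<open>\<rho>(Q)\<close> stay in \<open>\<rho>(Q)\<close>; for
  finite \<open>Q\<close> this is already a permutation. The index \<open>y\<close> need not be
  unique, as \<open>\<rho>\<close> may fail to be injective.\<close>

definition normalizer_SL ::
    "('a::field \<Rightarrow> 'v::ab_group_add \<Rightarrow> 'v) \<Rightarrow> 'q set \<Rightarrow> ('q \<Rightarrow> 'v \<Rightarrow> 'v) \<Rightarrow> ('v \<Rightarrow> 'v) set" where
  "normalizer_SL sc Q \<rho> =
     {f \<in> GL sc. endo_det sc f = 1 \<and> (\<forall>x\<in>Q. \<exists>y\<in>Q. f \<circ> \<rho> x = \<rho> y \<circ> f)}"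

lemma (in finite_dimensional_vector_space) normalizer_SL_comp:
  assumes f: "f \<in> normalizer_SL scale Q \<rho>" and g: "g \<in> normalizer_SL scale Q \<rho>"
  shows "f \<circ> g \<in> normalizer_SL scale Q \<rho>"
proof -
  have "\<exists>z\<in>Q. (f \<circ> g) \<circ> \<rho> x = \<rho> z \<circ> (f \<circ> g)" if x: "x \<in> Q" for x
  proof -
    obtain y where y: "y \<in> Q" "g \<circ> \<rho> x = \<rho> y \<circ> g"
      using g x by (auto simp: normalizer_SL_def)
    obtain z where z: "z \<in> Q" "f \<circ> \<rho> y = \<rho> z \<circ> f"
      using f y(1) by (auto simp: normalizer_SL_def)
    have "(f \<circ> g) \<circ> \<rho> x = (f \<circ> \<rho> y) \<circ> g"
      by (simp only: comp_assoc y(2))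
    also have "\<dots> = \<rho> z \<circ> (f \<circ> g)"
      by (simp only: comp_assoc z(2))
    finally show ?thesis
      using z(1) by blast
  qed
  moreover have "endo_det scale (f \<circ> g) = 1"
    using f g endo_det_comp[of f g] by (simp add: normalizer_SL_def GL_def)
  ultimately show ?thesis
    using f g GL_comp[of f g] by (simp add: normalizer_SL_def)
qed

lemma finite_normalizer_SL:
  fixes sc :: "complex \<Rightarrow> 'v::ab_group_add \<Rightarrow> 'v"
  assumes fd: "finite_dimensional_vector_space sc B" and nontriv: "\<exists>v::'v. v \<noteq> 0"
    and finQ: "finite Q" and irr: "irreducible_rep sc Q \<rho>"
    and lin: "\<And>x. x \<in> Q \<Longrightarrow> Vector_Spaces.linear sc sc (\<rho> x)"
  shows "finite (normalizer_SL sc Q \<rho>)"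
proof -
  interpret finite_dimensional_vector_space sc B by fact
  let ?G = "normalizer_SL sc Q \<rho>"
  \<comment> \<open>One \<open>f\<close> may induce several index maps \<open>\<phi>\<close>, so the
    normalizer is covered by the sets of maps inducing a given \<open>\<phi>\<close>; these may
    overlap.\<close>
  define induces where "induces = (\<lambda>f \<phi>. \<forall>x\<in>Q. f \<circ> \<rho> x = \<rho> (\<phi> x) \<circ> f)"
  have ex: "\<exists>\<phi>\<in>Q \<rightarrow>\<^sub>E Q. induces f \<phi>" if "f \<in> ?G" for f
  proof -
    have "\<forall>x\<in>Q. \<exists>y. y \<in> Q \<and> f \<circ> \<rho> x = \<rho> y \<circ> f"
      using that by (auto simp: normalizer_SL_def)
    then obtain \<phi> where "\<forall>x\<in>Q. \<phi> x \<in> Q \<and> f \<circ> \<rho> x = \<rho> (\<phi> x) \<circ> f"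
      by (rule bchoice[THEN exE])
    then show ?thesis
      \<comment> \<open>Restricting fixes the value of \<open>\<phi>\<close> outside
        \<open>Q\<close>, so that only finitely many index maps remain.\<close>
      by (intro bexI[of _ "restrict \<phi> Q"]) (auto simp: induces_def)
  qed
  have fibre: "finite {f \<in> ?G. induces f \<phi>}" for \<phi>
  proof (cases "{f \<in> ?G. induces f \<phi>} = {}")
    case False
    then obtain g where g: "g \<in> ?G" "induces g \<phi>" by blast
    define h where "h = Hilbert_Choice.inv g"
    have gGL: "g \<in> GL sc" using g by (simp add: normalizer_SL_def)
    have hGL: "h \<in> GL sc" unfolding h_def by (rule inv_in_GL[OF gGL])
    have hg: "h \<circ> g = id" "g \<circ> h = id"
      using gGL unfolding h_def GL_def by (simp_all add: bij_is_inj bij_is_surj surj_iff[symmetric])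
    \<comment> \<open>With \<open>g\<close> fixed in the fibre, every other member is a scalar
      multiple of it, the scalar being a root of unity.\<close>
    have "{f \<in> ?G. induces f \<phi>} \<subseteq> (\<lambda>c v. sc c (g v)) ` {c. c ^ dim UNIV = 1}"
    proof
      fix f assume "f \<in> {f \<in> ?G. induces f \<phi>}"
      then have f: "f \<in> ?G" "induces f \<phi>" by auto
      then have fGL: "f \<in> GL sc" by (simp add: normalizer_SL_def)
      have "(h \<circ> f) \<circ> \<rho> x = \<rho> x \<circ> (h \<circ> f)" if "x \<in> Q" for x
      proof -
        \<comment> \<open>Moving the inverse \<open>h\<close> of \<open>g\<close> past
          \<open>\<rho>\<close> undoes the index change \<open>\<phi>\<close> made by
          \<open>f\<close>, so \<open>h \<circ> f\<close> commutes with all of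
          \<open>\<rho>(Q)\<close> and Schur's lemma applies.\<close>
        have "\<rho> x \<circ> h = (h \<circ> g) \<circ> \<rho> x \<circ> h" by (simp add: hg)
        also have "\<dots> = h \<circ> (g \<circ> \<rho> x) \<circ> h" by (simp add: comp_assoc)
        also have "\<dots> = h \<circ> \<rho> (\<phi> x) \<circ> (g \<circ> h)"
          using g(2) that by (simp add: induces_def comp_assoc)
        finally have *: "\<rho> x \<circ> h = h \<circ> \<rho> (\<phi> x)" by (simp add: hg)
        have "(h \<circ> f) \<circ> \<rho> x = h \<circ> \<rho> (\<phi> x) \<circ> f"
          using f(2) that by (simp add: induces_def comp_assoc)
        also have "\<dots> = \<rho> x \<circ> (h \<circ> f)" by (simp add: * [symmetric] comp_assoc)
        finally show ?thesis .
      qed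
      moreover have "Vector_Spaces.linear sc sc (h \<circ> f)"
        using GL_comp[OF hGL fGL] by (simp add: GL_def)
      ultimately obtain c where c: "h \<circ> f = sc c"
        using schur_scalar[OF fd nontriv irr lin, of "h \<circ> f"] by blast
      have "f = g \<circ> (h \<circ> f)" by (simp add: hg comp_assoc[symmetric])
      also have "\<dots> = (\<lambda>v. sc c (g v))"
        unfolding c using gGL by (auto simp: GL_def Vector_Spaces.linear_iff)
      finally have fc: "f = (\<lambda>v. sc c (g v))" .
      then have "endo_det sc f = c ^ dim UNIV * endo_det sc g"
        using gGL endo_det_scale[of g c] by (simp add: GL_def)
      then have "c ^ dim UNIV = 1"
        using f g by (simp add: normalizer_SL_def)
      with fc show "f \<in> (\<lambda>c v. sc c (g v)) ` {c. c ^ dim UNIV = 1}" by blast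
    qed
    moreover have "finite {c::complex. c ^ dim UNIV = 1}"
      \<comment> \<open>A positive exponent is essential: for exponent zero every \<open>c\<close>
        would satisfy the equation.\<close>
      using dim_UNIV_pos[OF nontriv] by (intro finite_roots_unity) simp
    ultimately show ?thesis
      by (meson finite_imageI finite_subset)
  qed (simp only: finite.emptyI)
  have "?G \<subseteq> (\<Union>\<phi>\<in>Q \<rightarrow>\<^sub>E Q. {f \<in> ?G. induces f \<phi>})"
    using ex by blast
  moreover have "finite (\<Union>\<phi>\<in>Q \<rightarrow>\<^sub>E Q. {f \<in> ?G. induces f \<phi>})"
    using finQ fibre by (intro finite_UN_I finite_PiE)
  ultimately show ?thesis
    by (rule finite_subset)
qed

section \<open>Unitarity of the normalized representation\<close>

theorem proposition3p3:
  fixes Q :: "'q set" and op :: "'q \<Rightarrow> 'q \<Rightarrow> 'q"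
    and sc :: "complex \<Rightarrow> 'v::ab_group_add \<Rightarrow> 'v" and B :: "'v set"
    and \<rho> :: "'q \<Rightarrow> 'v \<Rightarrow> 'v"
  assumes "quandle Q op" and "finite Q"
    and "finite_dimensional_vector_space sc B"
    and "\<exists>v::'v. v \<noteq> 0"
    and "quandle_rep sc Q op \<rho>"
    and "irreducible_rep sc Q \<rho>"
  shows "quandle_rep sc Q op (twist sc (det_character sc \<rho>) \<rho>) \<and>
         irreducible_rep sc Q (twist sc (det_character sc \<rho>) \<rho>) \<and>
         (\<exists>ip. inner_product sc ip \<and> unitary_rep Q (twist sc (det_character sc \<rho>) \<rho>) ip)"
proof -
  interpret finite_dimensional_vector_space sc B by fact
  let ?\<chi> = "det_character sc \<rho>"
  let ?A = "twist sc ?\<chi> \<rho>"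
  let ?G = "normalizer_SL sc Q \<rho>"
  have closed: "op x y \<in> Q" if "x \<in> Q" "y \<in> Q" for x y
    using assms(1) that by (rule quandle.closed)
  have GL: "\<rho> x \<in> GL sc" if "x \<in> Q" for x
    using assms(5) that by (simp add: quandle_rep_def)
  have lin: "Vector_Spaces.linear sc sc (\<rho> x)" if "x \<in> Q" for x
    using GL[OF that] by (simp add: GL_def)
  have root: "nth_root (dim UNIV) z ^ dim UNIV = z" for z
    using dim_UNIV_pos[OF assms(4)] by (rule nth_root_power)
  \<comment> \<open>This says that \<open>\<chi>\<close> normalizes the determinant to one. As the
    dimension is positive, it also shows that \<open>\<chi>\<close> never vanishes.\<close>
  have pow: "?\<chi> x ^ dim UNIV * endo_det sc (\<rho> x) = 1" if "x \<in> Q" for x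
    using endo_det_nonzero[OF GL[OF that]] by (simp add: det_character_def power_divide root del: dim_UNIV)
  have nz: "?\<chi> x \<noteq> 0" if "x \<in> Q" for x
    using pow[OF that] dim_UNIV_pos[OF assms(4)] by (auto simp: zero_power)
  have rep: "quandle_rep sc Q op ?A"
    using vector_space_axioms assms(5) closed nz
  proof (rule quandle_rep_twist)
    fix x y assume "x \<in> Q" "y \<in> Q"
    then show "?\<chi> (op x y) = ?\<chi> y"
      \<comment> \<open>\<open>\<chi>\<close> is a function of the determinant alone, so the same
        value of the root is picked for \<open>op x y\<close> and for \<open>y\<close>.\<close>
      using endo_det_quandle_rep[OF assms(5) _ _ closed] by (simp add: det_character_def)
  qed
  have irr: "irreducible_rep sc Q ?A"
    using vector_space_axioms assms(6) nz by (rule irreducible_rep_twist)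
  have A_in: "?A x \<in> ?G" if x: "x \<in> Q" for x
  proof -
    have "?A x \<in> GL sc"
      using rep x by (simp add: quandle_rep_def)
    moreover have "endo_det sc (?A x) = 1"
      unfolding twist_eq endo_det_scale[OF lin[OF x]] by (rule pow[OF x])
    \<comment> \<open>Scalars are central, so \<open>?A x\<close> conjugates \<open>\<rho> y\<close>
      exactly as \<open>\<rho> x\<close> does.\<close>
    moreover have "?A x \<circ> \<rho> y = \<rho> (op x y) \<circ> ?A x" if y: "y \<in> Q" for y
    proof -
      have "\<rho> (op x y) (\<rho> x v) = \<rho> x (\<rho> y v)" for v
        using quandle_rep_comp[OF assms(5) x y] by (metis comp_apply)
      moreover have "\<rho> (op x y) (sc c v) = sc c (\<rho> (op x y) v)" for c v
        using lin[OF closed[OF x y]] by (simp add: Vector_Spaces.linear_iff)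
      ultimately show ?thesis
        by (simp add: twist_def fun_eq_iff)
    qed
    ultimately show ?thesis
      using closed[OF x] by (auto simp: normalizer_SL_def)
  qed
  have "\<exists>ip. inner_product sc ip \<and> unitary_rep Q ?A ip"
  \<comment> \<open>The maps \<open>?A x\<close> witness that the normalizer is nonempty. For empty
    \<open>Q\<close> unitarity is vacuous and any inner product serves.\<close>
  proof (cases "Q = {}")
    case True
    then show ?thesis
      using ex_inner_product[OF assms(3)] by (auto simp: unitary_rep_def)
  next
    case False
    then have "?G \<noteq> {}"
      using A_in by blast
    moreover have "finite ?G"
      using assms(3,4,2,6) lin by (rule finite_normalizer_SL)
    moreover have "?G \<subseteq> GL sc"
      by (auto simp: normalizer_SL_def)
    ultimately obtain ip where "inner_product sc ip" "\<forall>g\<in>?G. \<forall>v w. ip (g v) (g w) = ip v w"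
      using ex_invariant_inner_product[OF assms(3), of ?G] normalizer_SL_comp by blast
    then show ?thesis
      using A_in by (auto simp: unitary_rep_def)
  qed
  with rep irr show ?thesis by blast
qed

end
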